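(* Let $\mathcal{C}_N$ be a weighted cycle on $N$ vertices. Then for every $1\leq k\leq N$, \[ 2-\lambda_{N-k+1}\geq C_3\bigl(1-\overline{h}(k-1)\bigr)^2, \] with the convention $\overline{h}(0):=\overline{h}(1)$, where $C_3=\frac12$ if $N-k+1$ is odd or $N-k+1\in\{N-1,N\}$, and $C_3=\frac1{48}$ if $N-k+1\leq N-2$ is even.
   Context: A weighted cycle $\mathcal{C}_N$ ($N\geq3$) is a graph on vertices $v_1,\ldots,v_N$ whose edges are exactly $\{v_i,v_{i+1}\}$ (indices mod $N$), each with a positive weight $w_{uv}=w_{vu}$. Degrees $d_u=\sum_vw_{uv}$, $|E(A,B)|:=\sum_{u\in A,v\in B}w_{uv}$, $\mathrm{vol}(A)=\sum_{u\in A}d_u$. The normalized Laplacian $\Delta f(u)=\frac{1}{d_u}\sum_vw_{uv}(f(u)-f(v))$ has eigenvalues (with multiplicity) $0=\lambda_1\leq\cdots\leq\lambda_N\leq2$. For disjoint $V_1,V_2$ with $V_1\cup V_2\neq\emptyset$, $\overline{\phi}(V_1,V_2)=2|E(V_1,V_2)|/\mathrm{vol}(V_1\cup V_2)$; $\overline{h}(k):=\max\min_{1\leq i\leq k}\overline{\phi}(V_{2i-1},V_{2i})$ over all collections of $k$ pairs $(V_1,V_2),\ldots,(V_{2k-1},V_{2k})$ of pairwise disjoint subsets of the vertex set with $V_{2i-1}\cup V_{2i}\neq\emptyset$ for each $i$. *)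

theory Defs
  imports "Jordan_Normal_Form.Char_Poly" "HOL-Computational_Algebra.Fundamental_Theorem_Algebra"
begin

text \<open>Weighted cycle on vertices 0,...,N-1 (vertex v_i of the paper is i-1).
  The weight function c assigns to i the weight of the edge {i, (i+1) mod N}.\<close>

definition cyc_w :: "nat \<Rightarrow> (nat \<Rightarrow> real) \<Rightarrow> nat \<Rightarrow> nat \<Rightarrow> real" where
  "cyc_w N c u v =
     (if u < N \<and> v < N then
        (if v = Suc u mod N then c u else 0) + (if u = Suc v mod N then c v else 0)
      else 0)"

definition cyc_deg :: "nat \<Rightarrow> (nat \<Rightarrow> real) \<Rightarrow> nat \<Rightarrow> real" where
  "cyc_deg N c u = (\<Sum>v<N. cyc_w N c u v)"

definition cyc_E :: "nat \<Rightarrow> (nat \<Rightarrow> real) \<Rightarrow> nat set \<Rightarrow> nat set \<Rightarrow> real" where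
  "cyc_E N c A B = (\<Sum>u\<in>A. \<Sum>v\<in>B. cyc_w N c u v)"

definition cyc_vol :: "nat \<Rightarrow> (nat \<Rightarrow> real) \<Rightarrow> nat set \<Rightarrow> real" where
  "cyc_vol N c A = (\<Sum>u\<in>A. cyc_deg N c u)"

definition cyc_phi :: "nat \<Rightarrow> (nat \<Rightarrow> real) \<Rightarrow> nat set \<Rightarrow> nat set \<Rightarrow> real" where
  "cyc_phi N c A B = 2 * cyc_E N c A B / cyc_vol N c (A \<union> B)"

definition valid_pairs :: "nat \<Rightarrow> nat \<Rightarrow> (nat \<Rightarrow> nat set) \<Rightarrow> bool" where
  "valid_pairs N k V \<longleftrightarrow>
     (\<forall>i<2*k. V i \<subseteq> {..<N}) \<and>
     (\<forall>i<2*k. \<forall>j<2*k. i \<noteq> j \<longrightarrow> V i \<inter> V j = {}) \<and>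
     (\<forall>i<k. V (2*i) \<union> V (2*i+1) \<noteq> {})"

text \<open>The dual Cheeger constant h-bar(k) (for k \<ge> 1).\<close>
definition hbar :: "nat \<Rightarrow> (nat \<Rightarrow> real) \<Rightarrow> nat \<Rightarrow> real" where
  "hbar N c k = Max ((\<lambda>V. Min ((\<lambda>i. cyc_phi N c (V (2*i)) (V (2*i+1))) ` {..<k}))
                      ` {V. valid_pairs N k V})"

definition cyc_laplacian :: "nat \<Rightarrow> (nat \<Rightarrow> real) \<Rightarrow> real mat" where
  "cyc_laplacian N c = mat N N (\<lambda>(i,j). (if i = j then 1 else 0) - cyc_w N c i j / cyc_deg N c i)"

text \<open>Eigenvalues with multiplicity (roots of the characteristic polynomial over \<complex>,
  which are all real), sorted increasingly; lambda_j = cyc_eigs N c ! (j-1).\<close>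
definition cyc_eigs :: "nat \<Rightarrow> (nat \<Rightarrow> real) \<Rightarrow> real list" where
  "cyc_eigs N c = sorted_list_of_multiset
     (image_mset Re (proots (char_poly (map_mat complex_of_real (cyc_laplacian N c)))))"

end

theory Submission
  imports Defs "Jordan_Normal_Form.Jordan_Normal_Form_Existence"
begin

text \<open>
  Put \<open>\<mu> = 2 - \<lambda>\<^bsub>N-k+1\<^esub>\<close>, \<open>E(f) = \<Sum> w\<^bsub>uv\<^esub> (f(u) + f(v))\<^sup>2\<close> and \<open>D(f) = \<Sum> d\<^sub>u f(u)\<^sup>2\<close>.
  By the spectral theorem \<open>E \<le> \<mu> D\<close> on a \<open>k\<close>-dimensional space, so any \<open>k - 1\<close> vertices are zeros of
  a nonzero function with \<open>E \<le> \<mu> D\<close>. Delete vertex 0 and cut the remaining path greedily: repeatedly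
  split off the shortest initial segment that carries a nonzero function with \<open>E \<le> \<mu> D\<close>. If this
  produced fewer than \<open>k - 1\<close> segments, a nonzero function with \<open>E \<le> \<mu> D\<close> vanishing at vertex 0 and at
  the last vertex of each segment would decompose into separated pieces, on each of which \<open>E > \<mu> D\<close>
  by minimality. So there are \<open>k - 1\<close> disjointly supported functions with \<open>E \<le> \<mu> D\<close>, and the dual
  Cheeger sweep applied to each of them gives \<open>(1 - h(k-1))\<^sup>2 \<le> 2\<mu>\<close>. This yields the constant \<open>1/2\<close>
  in all cases.
\<close>

section \<open>Linear algebra: homogeneous systems and the shape of Jordan matrices\<close>

text \<open>Gaussian elimination, one equation at a time: if equation \<open>z\<close> has a pivot
  \<open>p\<close>, the unknown \<open>p\<close> is eliminated from the other equations, the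
  induction hypothesis solves the smaller system, and \<open>a p\<close> is then read off from
  equation \<open>z\<close>.\<close>

lemma homogeneous_system_nontrivial:
  fixes M :: "'z \<Rightarrow> 'i \<Rightarrow> 'a :: field"
  assumes "finite Z" and "finite I" and "card Z < card I"
  shows "\<exists>a. (\<exists>j\<in>I. a j \<noteq> 0) \<and> (\<forall>z\<in>Z. (\<Sum>j\<in>I. M z j * a j) = 0)"
  using assms
proof (induction Z arbitrary: I M rule: finite_induct)
  case empty
  then obtain j where "j \<in> I" by fastforce
  then show ?case by (intro exI[of _ "\<lambda>_. 1"]) auto
next
  case (insert z Z)
  show ?case
  proof (cases "\<forall>j\<in>I. M z j = 0")
    case True
    from insert.IH[of I M] insert.prems insert.hyps
    obtain a where "\<exists>j\<in>I. a j \<noteq> 0" "\<forall>z\<in>Z. (\<Sum>j\<in>I. M z j * a j) = 0"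
      by auto
    with True show ?thesis by (intro exI[of _ a]) auto
  next
    case False
    then obtain p where p: "p \<in> I" "M z p \<noteq> 0" by auto
    let ?I = "I - {p}"
    have "card Z < card ?I" using insert p by (simp add: card_Diff_singleton)
    from insert.IH[OF _ this, of "\<lambda>y j. M y j - M y p * M z j / M z p"] insert.prems
    obtain a where a: "\<exists>j\<in>?I. a j \<noteq> 0"
      "\<forall>y\<in>Z. (\<Sum>j\<in>?I. (M y j - M y p * M z j / M z p) * a j) = 0"
      by auto
    define s where "s = (\<Sum>j\<in>?I. M z j * a j)"
    define b where "b = a(p := - s / M z p)"
    have b: "(\<Sum>j\<in>I. M y j * b j) = (\<Sum>j\<in>?I. M y j * a j) - M y p * s / M z p" for y
    proof -
      have "(\<Sum>j\<in>?I. M y j * b j) = (\<Sum>j\<in>?I. M y j * a j)"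
        by (rule sum.cong) (auto simp: b_def)
      then show ?thesis
        using sum.remove[OF insert.prems(1) p(1), of "\<lambda>j. M y j * b j"] by (simp add: b_def)
    qed
    have "(\<Sum>j\<in>I. M y j * b j) = 0" if "y \<in> insert z Z" for y
    proof (cases "y = z")
      case True
      then show ?thesis using b[of z] p(2) by (simp add: s_def)
    next
      case False
      with that have "(\<Sum>j\<in>?I. (M y j - M y p * M z j / M z p) * a j) = 0" using a(2) by auto
      moreover have "(\<Sum>j\<in>?I. (M y j - M y p * M z j / M z p) * a j)
          = (\<Sum>j\<in>?I. M y j * a j) - M y p * s / M z p"
        by (simp add: s_def left_diff_distrib sum_subtractf sum_distrib_left sum_divide_distrib
            mult.assoc)
      ultimately show ?thesis using b[of y] by simp
    qed
    moreover have "\<exists>j\<in>I. b j \<noteq> 0" using a(1) by (auto simp: b_def)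
    ultimately show ?thesis by blast
  qed
qed

text \<open>A nonzero off-diagonal entry lies inside a single Jordan block, which has a constant
  diagonal. This form lets \<open>diagonalization\<close> exclude blocks of size above one without
  tracking block boundaries.\<close>

lemma jordan_matrix_off_diagonal:
  assumes "i < sum_list (map fst n_as)" and "j < sum_list (map fst n_as)" and "i \<noteq> j"
  shows "jordan_matrix n_as $$ (i, j) = 0 \<or>
    (j = Suc i \<and> jordan_matrix n_as $$ (i, j) = 1 \<and>
     jordan_matrix n_as $$ (i, i) = jordan_matrix n_as $$ (j, j))"
  using assms
proof (induction n_as arbitrary: i j)
  case (Cons na n_as)
  obtain n a where na: "na = (n, a)" by force
  show ?case
  proof (cases "i < n \<or> j < n")
    case True
    then show ?thesis using Cons.prems by (auto simp: na jordan_matrix_Cons)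
  next
    case False
    then have "j = Suc i \<longleftrightarrow> j - n = Suc (i - n)" and "i - n \<noteq> j - n"
      using Cons.prems by auto
    with False show ?thesis using Cons.IH[of "i - n" "j - n"] Cons.prems
      by (auto simp: na jordan_matrix_Cons)
  qed
qed simp

section \<open>The spectral theorem for a weighted inner product\<close>

definition weighted_inner ::
  "nat \<Rightarrow> (nat \<Rightarrow> real) \<Rightarrow> (nat \<Rightarrow> complex) \<Rightarrow> (nat \<Rightarrow> complex) \<Rightarrow> complex" where
  "weighted_inner n d x y = (\<Sum>i<n. of_real (d i) * x i * cnj (y i))"

lemma weighted_inner_self:
  "weighted_inner n d x x = of_real (\<Sum>i<n. d i * (cmod (x i))\<^sup>2)"
  unfolding weighted_inner_def of_real_sum
  by (intro sum.cong) (simp_all add: complex_norm_square[symmetric] mult.assoc)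

lemma weighted_inner_self_pos:
  assumes "\<And>i. i < n \<Longrightarrow> d i > 0" and "i < n" and "x i \<noteq> 0"
  shows "Re (weighted_inner n d x x) > 0"
proof -
  have "(\<Sum>i<n. d i * (cmod (x i))\<^sup>2) > 0"
    using assms by (intro sum_pos2[of _ i]) (auto simp: less_imp_le)
  then show ?thesis by (simp add: weighted_inner_self)
qed

lemma weighted_inner_add_left:
  "weighted_inner n d (\<lambda>i. x i + y i) z = weighted_inner n d x z + weighted_inner n d y z"
  by (simp add: weighted_inner_def algebra_simps sum.distrib)

lemma weighted_inner_scale_left:
  "weighted_inner n d (\<lambda>i. a * x i) z = a * weighted_inner n d x z"
  by (simp add: weighted_inner_def sum_distrib_left mult_ac)

lemma weighted_inner_scale_right:
  "weighted_inner n d x (\<lambda>i. a * z i) = cnj a * weighted_inner n d x z"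
  by (simp add: weighted_inner_def sum_distrib_left mult_ac)

lemma weighted_inner_cong:
  assumes "\<And>i. i < n \<Longrightarrow> x i = x' i" and "\<And>i. i < n \<Longrightarrow> y i = y' i"
  shows "weighted_inner n d x y = weighted_inner n d x' y'"
  unfolding weighted_inner_def using assms by (intro sum.cong) auto

definition mat_apply :: "nat \<Rightarrow> complex mat \<Rightarrow> (nat \<Rightarrow> complex) \<Rightarrow> nat \<Rightarrow> complex" where
  "mat_apply n A x i = (\<Sum>j<n. A $$ (i, j) * x j)"

text \<open>The condition \<open>symmetric\<close> says that diag(\<open>d\<close>) times
  \<open>A\<close> is Hermitian. The normalized Laplacian is not a symmetric matrix in general, but
  it satisfies this with the degrees as weights.\<close>

locale selfadjoint_mat =
  fixes n :: nat and d :: "nat \<Rightarrow> real" and A :: "complex mat"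
  assumes carrier: "A \<in> carrier_mat n n"
    and weight_pos: "\<And>i. i < n \<Longrightarrow> d i > 0"
    and symmetric: "\<And>i j. i < n \<Longrightarrow> j < n \<Longrightarrow>
      of_real (d i) * A $$ (i, j) = of_real (d j) * cnj (A $$ (j, i))"
begin

lemma adjoint:
  "weighted_inner n d (mat_apply n A x) y = weighted_inner n d x (mat_apply n A y)"
proof -
  have "weighted_inner n d (mat_apply n A x) y
      = (\<Sum>i<n. \<Sum>j<n. (of_real (d i) * A $$ (i, j)) * x j * cnj (y i))"
    by (simp add: weighted_inner_def mat_apply_def sum_distrib_left sum_distrib_right mult.assoc)
  also have "\<dots> = (\<Sum>i<n. \<Sum>j<n. (of_real (d j) * cnj (A $$ (j, i))) * x j * cnj (y i))"
    by (intro sum.cong refl) (simp add: symmetric)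
  also have "\<dots> = (\<Sum>j<n. \<Sum>i<n. (of_real (d j) * cnj (A $$ (j, i))) * x j * cnj (y i))"
    by (rule sum.swap)
  also have "\<dots> = weighted_inner n d x (mat_apply n A y)"
    by (simp add: weighted_inner_def mat_apply_def sum_distrib_left sum_distrib_right mult_ac)
  finally show ?thesis .
qed

lemma eigenvalue_real:
  assumes eig: "\<And>i. i < n \<Longrightarrow> mat_apply n A x i = l * x i" and "i < n" and "x i \<noteq> 0"
  shows "cnj l = l"
proof -
  have "l * weighted_inner n d x x = weighted_inner n d (mat_apply n A x) x"
    using eig by (subst weighted_inner_scale_left[symmetric]) (auto intro: weighted_inner_cong)
  also have "\<dots> = cnj l * weighted_inner n d x x"
    unfolding adjoint using eig
    by (subst weighted_inner_scale_right[symmetric]) (auto intro: weighted_inner_cong)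
  finally show ?thesis
    using weighted_inner_self_pos[of n d i x] weight_pos assms(2,3) by auto
qed

text \<open>The Jordan form over the complex numbers always exists; self-adjointness removes its
  superdiagonal ones column by column, so the columns of \<open>P\<close> are eigenvectors. They
  need not be orthogonal within an eigenspace, so \<open>Q\<close> is kept to express their
  independence.\<close>

lemma diagonalization:
  obtains P Q :: "complex mat" and e :: "nat \<Rightarrow> real"
  where "P \<in> carrier_mat n n" "Q \<in> carrier_mat n n" "Q * P = 1\<^sub>m n"
    and "\<And>i j. i < n \<Longrightarrow> j < n \<Longrightarrow>
      mat_apply n A (\<lambda>l. P $$ (l, j)) i = of_real (e j) * P $$ (i, j)"
    and "proots (char_poly A) = mset (map (\<lambda>j. of_real (e j)) [0..<n])"
proof -
  from char_poly_factorized[OF carrier] jordan_nf_exists[OF carrier]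
  obtain n_as where "jordan_nf A n_as" by blast
  then have sim: "similar_mat A (jordan_matrix n_as)" by (simp add: jordan_nf_def)
  define J where "J = jordan_matrix n_as"
  from sim obtain P Q where "similar_mat_wit A J P Q" unfolding similar_mat_def J_def by blast
  from similar_mat_witD2[OF carrier this]
  have PQ: "P * Q = 1\<^sub>m n" "Q * P = 1\<^sub>m n" "A = P * J * Q"
    and carr: "J \<in> carrier_mat n n" "P \<in> carrier_mat n n" "Q \<in> carrier_mat n n" by auto
  have dim: "sum_list (map fst n_as) = n" using carr(1) by (auto simp: J_def)
  have AP: "A * P = P * J"
    using PQ carr by (simp add: assoc_mult_mat[of _ n n _ n _ n])
  have col: "mat_apply n A (\<lambda>l. P $$ (l, j)) i = (\<Sum>l<n. P $$ (i, l) * J $$ (l, j))"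
    if "i < n" "j < n" for i j
    using arg_cong[OF AP, of "\<lambda>M. M $$ (i, j)"] that carrier carr
    by (simp add: mat_apply_def scalar_prod_def atLeast0LessThan)
  have col_nz: "\<exists>i<n. P $$ (i, j) \<noteq> 0" if "j < n" for j
  proof (rule ccontr)
    assume "\<not> ?thesis"
    then have "(Q * P) $$ (j, j) = 0"
      using that carr by (auto simp: scalar_prod_def intro!: sum.neutral)
    then show False using PQ that by simp
  qed
  have off: "J $$ (i, j) = 0 \<or> (j = Suc i \<and> J $$ (i, j) = 1 \<and> J $$ (i, i) = J $$ (j, j))"
    if "i < n" "j < n" "i \<noteq> j" for i j
    using jordan_matrix_off_diagonal[of i n_as j] that dim by (simp add: J_def)
  have eig: "mat_apply n A (\<lambda>l. P $$ (l, j)) i = J $$ (j, j) * P $$ (i, j)"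
    if "\<And>l. l < n \<Longrightarrow> l \<noteq> j \<Longrightarrow> J $$ (l, j) = 0" "i < n" "j < n" for i j
  proof -
    have "(\<Sum>l<n. P $$ (i, l) * J $$ (l, j)) = (\<Sum>l\<in>{j}. P $$ (i, l) * J $$ (l, j))"
      using that by (intro sum.mono_neutral_right) auto
    then show ?thesis using col[of i j] that by simp
  qed
  have real_if_diag: "cnj (J $$ (j, j)) = J $$ (j, j)"
    if "\<And>l. l < n \<Longrightarrow> l \<noteq> j \<Longrightarrow> J $$ (l, j) = 0" "j < n" for j
  proof -
    obtain i where "i < n" "P $$ (i, j) \<noteq> 0" using col_nz \<open>j < n\<close> by blast
    then show ?thesis
      using eigenvalue_real[of "\<lambda>l. P $$ (l, j)" "J $$ (j, j)" i] eig that by blast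
  qed
  \<comment> \<open>The first generalized eigenvector \<open>p\<^sub>j\<close> with \<open>A p\<^sub>j = \<lambda> p\<^sub>j + p\<^sub>i\<close> would force
    \<open>\<langle>p\<^sub>i, p\<^sub>i\<rangle> = \<langle>(A - \<lambda>) p\<^sub>j, p\<^sub>i\<rangle> = \<langle>p\<^sub>j, (A - \<lambda>) p\<^sub>i\<rangle> = 0\<close>.\<close>
  have diag: "\<forall>l<n. l \<noteq> j \<longrightarrow> J $$ (l, j) = 0" if "j < n" for j
    using that
  proof (induction j rule: less_induct)
    case (less j)
    show ?case
    proof (rule ccontr)
      assume "\<not> ?thesis"
      then obtain i where i: "i < n" "i \<noteq> j" "J $$ (i, j) \<noteq> 0" by auto
      with off[OF i(1) less.prems i(2)]
      have ij: "j = Suc i" "J $$ (i, j) = 1" "J $$ (i, i) = J $$ (j, j)" by auto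
      \<comment> \<open>Column \<open>i\<close> precedes column \<open>j\<close>, so the induction
        hypothesis already makes it a genuine eigenvector; its eigenvalue \<open>l\<close> is
        therefore real.\<close>
      have di: "\<And>l. l < n \<Longrightarrow> l \<noteq> i \<Longrightarrow> J $$ (l, i) = 0" using less.IH[of i] ij i by auto
      define l where "l = J $$ (j, j)"
      let ?p = "\<lambda>j l. P $$ (l, j)"
      have Ai: "mat_apply n A (?p i) m = l * ?p i m" if "m < n" for m
        using eig[OF di that i(1)] ij by (simp add: l_def)
      have Aj: "mat_apply n A (?p j) m = l * ?p j m + ?p i m" if "m < n" for m
      proof -
        have "(\<Sum>r<n. P $$ (m, r) * J $$ (r, j)) = (\<Sum>r\<in>{i, j}. P $$ (m, r) * J $$ (r, j))"
        proof (intro sum.mono_neutral_right ballI)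
          fix r assume "r \<in> {..<n} - {i, j}"
          then show "P $$ (m, r) * J $$ (r, j) = 0"
            using off[of r j] less.prems ij(1) by auto
        qed (use less.prems i in auto)
        then show ?thesis using col[OF that less.prems] i ij by (simp add: l_def)
      qed
      have "l * weighted_inner n d (?p j) (?p i) + weighted_inner n d (?p i) (?p i)
          = weighted_inner n d (mat_apply n A (?p j)) (?p i)"
        by (subst weighted_inner_scale_left[symmetric], subst weighted_inner_add_left[symmetric])
          (auto intro: weighted_inner_cong simp: Aj)
      also have "\<dots> = cnj l * weighted_inner n d (?p j) (?p i)"
        unfolding adjoint
        by (subst weighted_inner_scale_right[symmetric]) (auto intro: weighted_inner_cong simp: Ai)
      also have "cnj l = l" using real_if_diag[OF di i(1)] ij by (simp add: l_def)
      finally have "weighted_inner n d (?p i) (?p i) = 0" by simp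
      moreover obtain m where "m < n" "?p i m \<noteq> 0" using col_nz i(1) by blast
      ultimately show False using weighted_inner_self_pos[of n d m "?p i"] weight_pos by auto
    qed
  qed
  define e where "e j = Re (J $$ (j, j))" for j
  have e: "of_real (e j) = J $$ (j, j)" if "j < n" for j
    using real_if_diag[of j] diag[of j] that unfolding e_def
    by (metis Reals_cnj_iff of_real_Re)
  have "upper_triangular J"
    using diag carr(1) unfolding upper_triangular_def by auto
  then have "char_poly A = (\<Prod>a\<leftarrow>diag_mat J. [:- a, 1:])"
    using char_poly_similar[OF sim] char_poly_upper_triangular[OF carr(1)] by (simp add: J_def)
  moreover have "proots (\<Prod>a\<leftarrow>as. [:- a, 1:]) = mset as" for as :: "complex list"
  proof (induction as)
    case (Cons a as)
    have "(\<Prod>a\<leftarrow>as. [:- a, 1:]) \<noteq> 0" by (auto simp: prod_list_zero_iff)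
    then have "proots ([:- a, 1:] * (\<Prod>a\<leftarrow>as. [:- a, 1:])) = {#a#} + mset as"
      using Cons.IH by (subst proots_mult) simp_all
    then show ?case by (simp only: list.map prod_list.Cons) simp
  qed simp
  ultimately have "proots (char_poly A) = mset (diag_mat J)" by simp
  also have "diag_mat J = map (\<lambda>j. of_real (e j)) [0..<n]"
    using carr(1) e by (auto simp: diag_mat_def)
  finally show ?thesis
  proof (rule that[OF carr(2,3) PQ(2), rotated])
    fix i j assume ij: "i < n" "j < n"
    show "mat_apply n A (\<lambda>l. P $$ (l, j)) i = of_real (e j) * P $$ (i, j)"
      unfolding e[OF ij(2)] by (rule eig) (use diag[OF ij(2)] ij in auto)
  qed
qed

text \<open>Dimension count: the eigenvectors with eigenvalue at least \<open>l\<close> outnumber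
  the vertices of \<open>Z\<close>, so a nontrivial combination of them vanishes on
  \<open>Z\<close>, and its Rayleigh quotient is at least \<open>l\<close>.\<close>

lemma test_vector:
  assumes "finite Z" and "card Z < size (filter_mset (\<lambda>z. l \<le> Re z) (proots (char_poly A)))"
  obtains x where "\<exists>i<n. x i \<noteq> 0" and "\<And>i. i \<in> Z \<Longrightarrow> x i = 0"
    and "l * Re (weighted_inner n d x x) \<le> Re (weighted_inner n d (mat_apply n A x) x)"
proof -
  obtain P Q e where P: "P \<in> carrier_mat n n" "Q \<in> carrier_mat n n" "Q * P = 1\<^sub>m n"
    and eig: "\<And>i j. i < n \<Longrightarrow> j < n \<Longrightarrow>
      mat_apply n A (\<lambda>l. P $$ (l, j)) i = of_real (e j) * P $$ (i, j)"
    and roots: "proots (char_poly A) = mset (map (\<lambda>j. of_real (e j)) [0..<n])"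
    using diagonalization by metis
  define I where "I = {j. j < n \<and> l \<le> e j}"
  have I: "finite I" "I \<subseteq> {..<n}" by (auto simp: I_def)
  have "size (filter_mset (\<lambda>z. l \<le> Re z) (proots (char_poly A)))
      = length (filter (\<lambda>j. l \<le> e j) [0..<n])"
    unfolding roots mset_filter[symmetric] size_mset by (simp add: filter_map o_def)
  also have "\<dots> = card I" by (simp add: length_filter_conv_card I_def cong: conj_cong)
  finally have "card Z < card I" using assms(2) by simp
  from homogeneous_system_nontrivial[OF assms(1) I(1) this, of "\<lambda>z j. P $$ (z, j)"]
  obtain a where a: "\<exists>j\<in>I. a j \<noteq> 0" "\<forall>z\<in>Z. (\<Sum>j\<in>I. P $$ (z, j) * a j) = 0" by auto
  define comb where "comb b i = (\<Sum>j\<in>I. P $$ (i, j) * b j)" for b i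
  define G where "G i j = weighted_inner n d (\<lambda>l. P $$ (l, i)) (\<lambda>l. P $$ (l, j))" for i j
  have G: "G i j = 0" if "i \<in> I" "j \<in> I" "e i \<noteq> e j" for i j
  proof -
    have ij: "i < n" "j < n" using that I by auto
    have "of_real (e i) * G i j = weighted_inner n d (mat_apply n A (\<lambda>l. P $$ (l, i))) (\<lambda>l. P $$ (l, j))"
      unfolding G_def
      by (subst weighted_inner_scale_left[symmetric]) (auto intro: weighted_inner_cong simp: eig ij)
    also have "\<dots> = cnj (of_real (e j)) * G i j"
      unfolding adjoint G_def
      by (subst weighted_inner_scale_right[symmetric]) (auto intro: weighted_inner_cong simp: eig ij)
    finally show ?thesis using that by auto
  qed
  have inner_comb: "weighted_inner n d (comb b) (comb b') = (\<Sum>i\<in>I. \<Sum>j\<in>I. b i * cnj (b' j) * G i j)"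
    for b b'
  proof -
    have "weighted_inner n d (comb b) (comb b')
      = (\<Sum>l<n. \<Sum>i\<in>I. \<Sum>j\<in>I. b i * cnj (b' j) * (of_real (d l) * P $$ (l, i) * cnj (P $$ (l, j))))"
      unfolding weighted_inner_def comb_def cnj_sum mult.assoc sum_product
      by (simp add: sum_distrib_left mult_ac)
    also have "\<dots> = (\<Sum>i\<in>I. \<Sum>j\<in>I. \<Sum>l<n. b i * cnj (b' j) * (of_real (d l) * P $$ (l, i) * cnj (P $$ (l, j))))"
      by (subst sum.swap, rule sum.cong[OF refl], rule sum.swap)
    finally show ?thesis by (simp add: G_def weighted_inner_def sum_distrib_left)
  qed
  have apply_comb: "mat_apply n A (comb a) i = comb (\<lambda>j. of_real (e j) * a j) i" if "i < n" for i
  proof -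
    have "mat_apply n A (comb a) i = (\<Sum>j\<in>I. (\<Sum>l<n. A $$ (i, l) * P $$ (l, j)) * a j)"
      unfolding mat_apply_def comb_def sum_distrib_left sum_distrib_right
      by (subst sum.swap) (simp add: mult_ac)
    also have "\<dots> = (\<Sum>j\<in>I. of_real (e j) * P $$ (i, j) * a j)"
      using eig[OF that] I by (intro sum.cong) (auto simp: mat_apply_def)
    finally show ?thesis by (simp add: comb_def mult_ac)
  qed
  \<comment> \<open>Since eigenvectors to different eigenvalues are orthogonal, \<open>\<langle>(A - l)x, x\<rangle> = \<langle>y, y\<rangle>\<close> where
    \<open>y\<close> is obtained from \<open>x\<close> by scaling the coefficient \<open>a\<^sub>j\<close> with \<open>sqrt (e\<^sub>j - l)\<close>.\<close>
  define b where "b j = of_real (sqrt (e j - l)) * a j" for j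
  have "weighted_inner n d (mat_apply n A (comb a)) (comb a) - of_real l * weighted_inner n d (comb a) (comb a)
      = weighted_inner n d (comb (\<lambda>j. of_real (e j) * a j)) (comb a)
        - of_real l * weighted_inner n d (comb a) (comb a)"
    using apply_comb by (auto intro!: arg_cong2[where f = minus] weighted_inner_cong)
  also have "\<dots> = (\<Sum>i\<in>I. \<Sum>j\<in>I. of_real (e i - l) * a i * cnj (a j) * G i j)"
    unfolding inner_comb by (simp add: sum_distrib_left sum_subtractf algebra_simps)
  also have "\<dots> = (\<Sum>i\<in>I. \<Sum>j\<in>I. b i * cnj (b j) * G i j)"
  proof (intro sum.cong refl)
    fix i j assume ij: "i \<in> I" "j \<in> I"
    show "of_real (e i - l) * a i * cnj (a j) * G i j = b i * cnj (b j) * G i j"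
    proof (cases "e i = e j")
      case True
      have "b i * cnj (b j) * G i j
          = of_real (sqrt (e j - l) * sqrt (e j - l)) * a i * cnj (a j) * G i j"
        unfolding b_def True of_real_mult by (simp add: mult_ac)
      also have "sqrt (e j - l) * sqrt (e j - l) = e i - l" using ij True by (simp add: I_def)
      finally show ?thesis by (rule sym)
    next
      case False
      then show ?thesis using G[OF ij] by simp
    qed
  qed
  also have "\<dots> = weighted_inner n d (comb b) (comb b)" by (simp add: inner_comb)
  finally have "Re (weighted_inner n d (mat_apply n A (comb a)) (comb a)
        - of_real l * weighted_inner n d (comb a) (comb a))
      = Re (weighted_inner n d (comb b) (comb b))"
    by (rule arg_cong)
  then have "Re (weighted_inner n d (mat_apply n A (comb a)) (comb a))
        - l * Re (weighted_inner n d (comb a) (comb a))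
      = Re (weighted_inner n d (comb b) (comb b))"
    by simp
  also have "\<dots> = (\<Sum>i<n. d i * (cmod (comb b i))\<^sup>2)" by (simp only: weighted_inner_self Re_complex_of_real)
  also have "\<dots> \<ge> 0" using weight_pos by (intro sum_nonneg) (auto simp: less_imp_le)
  finally have le: "l * Re (weighted_inner n d (comb a) (comb a)) \<le> Re (weighted_inner n d (mat_apply n A (comb a)) (comb a))"
    by simp
  \<comment> \<open>Row \<open>j\<close> of the left inverse \<open>Q\<close> recovers the
    coefficient \<open>a j\<close> from the combination, so a nonzero coefficient forces a nonzero
    vector.\<close>
  have nz: "\<exists>i<n. comb a i \<noteq> 0"
  proof (rule ccontr)
    assume z: "\<not> ?thesis"
    obtain j where j: "j \<in> I" "a j \<noteq> 0" using a(1) by auto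
    have "(\<Sum>i<n. Q $$ (j, i) * comb a i) = (\<Sum>k\<in>I. (\<Sum>i<n. Q $$ (j, i) * P $$ (i, k)) * a k)"
      unfolding comb_def sum_distrib_left sum_distrib_right
      by (subst sum.swap) (simp add: mult_ac)
    also have "\<dots> = (\<Sum>k\<in>I. (Q * P) $$ (j, k) * a k)"
      using P(1,2) j by (intro sum.cong refl) (simp add: I_def scalar_prod_def atLeast0LessThan)
    also have "\<dots> = (\<Sum>k\<in>I. if k = j then a k else 0)"
      unfolding P(3) using j by (intro sum.cong refl) (auto simp: I_def)
    also have "\<dots> = a j" using j I by simp
    finally show False using z j by simp
  qed
  show ?thesis by (rule that[OF nz _ le]) (use a(2) in \<open>auto simp: comb_def\<close>)
qed

end

section \<open>Two real inequalities behind the sweep\<close>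

text \<open>A discrete layer-cake formula: peeling off the smallest positive value \<open>m\<close>
  of \<open>b\<close> contributes \<open>m\<close> times a level sum, and what remains,
  \<open>b'\<close>, has fewer positive entries and level sets that are level sets of
  \<open>b\<close>. It is used in contrapositive form, to find a threshold with a nonpositive level
  sum.\<close>

lemma sum_pos_if_level_sums_pos:
  fixes a b :: "'i \<Rightarrow> real"
  assumes "finite I" and "\<And>i. i \<in> I \<Longrightarrow> b i \<ge> 0" and "\<exists>i\<in>I. b i > 0"
    and "\<And>t. t > 0 \<Longrightarrow> \<exists>i\<in>I. t \<le> b i \<Longrightarrow> (\<Sum>i\<in>{i\<in>I. t \<le> b i}. a i) > 0"
  shows "(\<Sum>i\<in>I. a i * b i) > 0"
  using assms(2-)
proof (induction "card {i\<in>I. b i > 0}" arbitrary: b rule: less_induct)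
  case less
  define S where "S = {i\<in>I. b i > 0}"
  have S: "finite S" "S \<noteq> {}" "S \<subseteq> I" using assms(1) less.prems(2) by (auto simp: S_def)
  define m where "m = Min (b ` S)"
  have "m \<in> b ` S" unfolding m_def using S by (intro Min_in) auto
  then obtain p where p: "p \<in> S" "b p = m" by auto
  have m_le: "m \<le> b i" if "i \<in> S" for i unfolding m_def using S that by simp
  have m: "m > 0" using p by (auto simp: S_def)
  have S_level: "S = {i\<in>I. m \<le> b i}" using m m_le by (auto simp: S_def)
  define b' where "b' i = max 0 (b i - m)" for i
  have "(\<Sum>i\<in>I. a i * b i) = (\<Sum>i\<in>S. a i * b i)"
    using assms(1) less.prems(1) S(3)
    by (intro sum.mono_neutral_right) (force simp: S_def)+
  also have "\<dots> = (\<Sum>i\<in>S. a i * b' i + m * a i)"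
    using m_le by (intro sum.cong refl) (auto simp: b'_def algebra_simps)
  also have "\<dots> = (\<Sum>i\<in>I. a i * b' i) + m * (\<Sum>i\<in>S. a i)"
  proof -
    have "(\<Sum>i\<in>I. a i * b' i) = (\<Sum>i\<in>S. a i * b' i)"
      using assms(1) by (intro sum.mono_neutral_right) (auto simp: S_level b'_def)
    then show ?thesis by (simp add: sum.distrib sum_distrib_left)
  qed
  finally have eq: "(\<Sum>i\<in>I. a i * b i) = (\<Sum>i\<in>I. a i * b' i) + m * (\<Sum>i\<in>S. a i)" .
  have "(\<Sum>i\<in>S. a i) > 0" unfolding S_level using less.prems(3)[OF m] p S by auto
  with m have "m * (\<Sum>i\<in>S. a i) > 0" by simp
  moreover have "(\<Sum>i\<in>I. a i * b' i) \<ge> 0"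
  proof (cases "\<exists>i\<in>I. b' i > 0")
    case True
    have "{i\<in>I. b' i > 0} \<subseteq> S - {p}" using p m by (auto simp: S_def b'_def)
    then have "{i\<in>I. b' i > 0} \<subset> S" using p(1) by blast
    then have "card {i\<in>I. b' i > 0} < card {i\<in>I. b i > 0}"
      using S(1) unfolding S_def by (intro psubset_card_mono) auto
    moreover have "(\<Sum>i\<in>{i\<in>I. t \<le> b' i}. a i) > 0" if "t > 0" "\<exists>i\<in>I. t \<le> b' i" for t
    proof -
      have "{i\<in>I. t \<le> b' i} = {i\<in>I. t + m \<le> b i}" using that by (auto simp: b'_def)
      with less.prems(3)[of "t + m"] that m show ?thesis by (auto simp: b'_def)
    qed
    ultimately show ?thesis
      using less.hyps[of b'] True by (force simp: b'_def)
  next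
    case False
    then have "b' i = 0" if "i \<in> I" for i using that by (force simp: b'_def)
    then show ?thesis by simp
  qed
  ultimately show ?case using eq by simp
qed

text \<open>With z = \<bar>x\<bar> + \<bar>y\<bar>, the left side is at most \<bar>x + y\<bar> z:
  for opposite signs both equal the absolute difference of the squares. The weighted
  arithmetic-geometric mean inequality with parameter \<open>s\<close> splits this product, and z
  squared is at most twice the sum of the squares.\<close>

lemma edge_inequality:
  fixes x y s :: real
  assumes "s > 0"
  shows "x\<^sup>2 + y\<^sup>2 - (if x * y < 0 then 2 * min (x\<^sup>2) (y\<^sup>2) else 0)
    \<le> (x + y)\<^sup>2 / s + s / 2 * (x\<^sup>2 + y\<^sup>2)"
proof -
  let ?z = "\<bar>x\<bar> + \<bar>y\<bar>"
  have "x\<^sup>2 + y\<^sup>2 - (if x * y < 0 then 2 * min (x\<^sup>2) (y\<^sup>2) else 0) \<le> \<bar>x + y\<bar> * ?z"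
  proof (cases "x * y < 0")
    case True
    then have "?z = \<bar>x - y\<bar>" by (auto simp: mult_less_0_iff)
    then have "\<bar>x + y\<bar> * ?z = \<bar>x\<^sup>2 - y\<^sup>2\<bar>"
      by (simp add: abs_mult[symmetric] power2_eq_square algebra_simps)
    then show ?thesis using True by (auto simp: min_def)
  next
    case False
    then have "?z = \<bar>x + y\<bar>" by (auto simp: not_less zero_le_mult_iff)
    then have "\<bar>x + y\<bar> * ?z = (x + y)\<^sup>2" by (simp add: power2_eq_square)
    then show ?thesis using False by (simp add: power2_eq_square algebra_simps)
  qed
  also have "\<bar>x + y\<bar> * ?z \<le> (x + y)\<^sup>2 / s + s / 4 * ?z\<^sup>2"
  proof -
    have "0 \<le> (2 * \<bar>x + y\<bar> - s * ?z)\<^sup>2 / (4 * s)" using assms by simp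
    also have "\<dots> = (x + y)\<^sup>2 / s + s / 4 * ?z\<^sup>2 - \<bar>x + y\<bar> * ?z"
    proof -
      have "(2 * \<bar>x + y\<bar> - s * ?z)\<^sup>2 = 4 * (x + y)\<^sup>2 + s\<^sup>2 * ?z\<^sup>2 - 4 * s * \<bar>x + y\<bar> * ?z"
        unfolding power2_diff power_mult_distrib power2_abs by simp
      then show ?thesis using assms by (simp add: field_simps power2_eq_square)
    qed
    finally show ?thesis by simp
  qed
  also have "s / 4 * ?z\<^sup>2 \<le> s / 2 * (x\<^sup>2 + y\<^sup>2)"
  proof -
    have "?z\<^sup>2 \<le> 2 * (x\<^sup>2 + y\<^sup>2)"
      using zero_le_power2[of "\<bar>x\<bar> - \<bar>y\<bar>"] by (simp add: power2_sum power2_diff)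
    then have "s / 4 * ?z\<^sup>2 \<le> s / 4 * (2 * (x\<^sup>2 + y\<^sup>2))" using assms by (intro mult_left_mono) auto
    then show ?thesis by (simp add: algebra_simps)
  qed
  finally show ?thesis by simp
qed

section \<open>Weighted cycles, their quadratic forms, and the dual Cheeger sweep\<close>

locale weighted_cycle =
  fixes N :: nat and c :: "nat \<Rightarrow> real"
  assumes three_le: "N \<ge> 3" and weight_pos: "\<And>i. i < N \<Longrightarrow> c i > 0"
begin

definition nxt :: "nat \<Rightarrow> nat" where
  "nxt i = Suc i mod N"

lemma nxt_less: "nxt i < N"
  using three_le by (simp add: nxt_def)

lemma cyc_w_sym: "cyc_w N c u v = cyc_w N c v u"
  by (simp add: cyc_w_def)

lemma cyc_w_nonneg: "cyc_w N c u v \<ge> 0"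
  using weight_pos by (auto simp: cyc_w_def less_imp_le)

text \<open>The two summands of \<open>cyc_w\<close> are the two orientations of an edge. Degrees,
  cuts and the Laplacian form all pass through this identity to become sums over the
  \<open>N\<close> edges.\<close>

lemma sum_edges:
  "(\<Sum>u<N. \<Sum>v<N. cyc_w N c u v * F u v) = (\<Sum>i<N. c i * (F i (nxt i) + F (nxt i) i))"
proof -
  have "(\<Sum>u<N. \<Sum>v<N. cyc_w N c u v * F u v)
      = (\<Sum>u<N. \<Sum>v<N. if v = nxt u then c u * F u v else 0)
        + (\<Sum>u<N. \<Sum>v<N. if u = nxt v then c v * F u v else 0)"
    unfolding sum.distrib[symmetric]
    by (intro sum.cong refl) (auto simp: cyc_w_def nxt_def algebra_simps)
  also have "(\<Sum>u<N. \<Sum>v<N. if u = nxt v then c v * F u v else 0)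
      = (\<Sum>v<N. \<Sum>u<N. if u = nxt v then c v * F u v else 0)"
    by (rule sum.swap)
  also have "\<dots> = (\<Sum>v<N. c v * F (nxt v) v)" by (simp add: nxt_less)
  also have "(\<Sum>u<N. \<Sum>v<N. if v = nxt u then c u * F u v else 0) = (\<Sum>u<N. c u * F u (nxt u))"
    by (simp add: nxt_less)
  finally show ?thesis by (simp add: algebra_simps sum.distrib)
qed

lemma sum_deg: "(\<Sum>u<N. cyc_deg N c u * h u) = (\<Sum>i<N. c i * (h i + h (nxt i)))"
  using sum_edges[of "\<lambda>u v. h u"] by (simp add: cyc_deg_def sum_distrib_right)

lemma deg_pos:
  assumes "u < N"
  shows "cyc_deg N c u > 0"
proof -
  have "c u \<le> cyc_w N c u (nxt u)"
    using assms weight_pos nxt_less by (auto simp: cyc_w_def nxt_def less_imp_le)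
  also have "\<dots> \<le> cyc_deg N c u"
    unfolding cyc_deg_def using nxt_less by (intro member_le_sum) (auto simp: cyc_w_nonneg)
  finally show ?thesis using weight_pos[OF assms] by simp
qed

text \<open>The signless Laplacian form, which is the form of 2 minus the normalized Laplacian in
  the degree inner product (see \<open>laplacian_form\<close>).\<close>

definition energy :: "(nat \<Rightarrow> real) \<Rightarrow> real" where
  "energy f = (\<Sum>i<N. c i * (f i + f (nxt i))\<^sup>2)"

definition mass :: "(nat \<Rightarrow> real) \<Rightarrow> real" where
  "mass f = (\<Sum>u<N. cyc_deg N c u * (f u)\<^sup>2)"

lemma energy_nonneg: "energy f \<ge> 0"
  unfolding energy_def using weight_pos by (intro sum_nonneg) (auto simp: less_imp_le)

lemma mass_pos:
  assumes "u < N" and "f u \<noteq> 0"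
  shows "mass f > 0"
  unfolding mass_def using assms deg_pos
  by (intro sum_pos2[of _ u]) (auto simp: less_imp_le)

lemma vol_pos:
  assumes "A \<subseteq> {..<N}" and "A \<noteq> {}"
  shows "cyc_vol N c A > 0"
  unfolding cyc_vol_def using assms deg_pos finite_subset[OF assms(1)] by (intro sum_pos) auto

lemma cyc_E_le_vol:
  assumes "A \<subseteq> {..<N}" and "B \<subseteq> {..<N}"
  shows "cyc_E N c A B \<le> cyc_vol N c A"
  unfolding cyc_E_def cyc_vol_def cyc_deg_def using assms
  by (intro sum_mono sum_mono2) (auto simp: cyc_w_nonneg)

lemma phi_le_1:
  assumes "A \<subseteq> {..<N}" and "B \<subseteq> {..<N}" and "A \<inter> B = {}" and "A \<union> B \<noteq> {}"
  shows "cyc_phi N c A B \<le> 1"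
proof -
  have "cyc_E N c A B = cyc_E N c B A"
    unfolding cyc_E_def by (subst sum.swap) (simp add: cyc_w_sym)
  then have "2 * cyc_E N c A B \<le> cyc_vol N c A + cyc_vol N c B"
    using cyc_E_le_vol[of A B] cyc_E_le_vol[of B A] assms by simp
  also have "\<dots> = cyc_vol N c (A \<union> B)"
    unfolding cyc_vol_def using assms by (intro sum.union_disjoint[symmetric]) (auto intro: finite_subset)
  finally show ?thesis
    using vol_pos[of "A \<union> B"] assms by (simp add: cyc_phi_def)
qed

text \<open>The witnesses are the parts of a superlevel set of \<open>g\<^sup>2\<close> on which \<open>g\<close> is positive and negative.\<close>

lemma sweep:
  assumes "s > 0" and le: "2 * energy g \<le> s\<^sup>2 * mass g" and "u < N" and "g u \<noteq> 0"
  obtains A B where "A \<subseteq> {v. v < N \<and> g v \<noteq> 0}" and "B \<subseteq> {v. v < N \<and> g v \<noteq> 0}"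
    and "A \<inter> B = {}" and "A \<union> B \<noteq> {}" and "1 - s \<le> cyc_phi N c A B"
proof -
  \<comment> \<open>Vertices and edges are put into one index set so that the layer-cake lemma
    handles both at once. An edge enters a level set when both its ends do, and it counts only if
    \<open>g\<close> changes sign along it. Hence the level sum at \<open>t\<close> is (1 -
    \<open>s\<close>) times the volume of \<open>A \<union> B\<close>, minus twice the cut between
    \<open>A\<close> and \<open>B\<close>.\<close>
  define a where "a = case_sum (\<lambda>v. (1 - s) * cyc_deg N c v)
    (\<lambda>i. if g i * g (nxt i) < 0 then - 2 * c i else 0)"
  define b where "b = case_sum (\<lambda>v. (g v)\<^sup>2) (\<lambda>i. min ((g i)\<^sup>2) ((g (nxt i))\<^sup>2))"
  define I where "I = {..<N} <+> {..<N}"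
  have "(\<Sum>i\<in>I. a i * b i) = (1 - s) * mass g
      - (\<Sum>i<N. c i * (if g i * g (nxt i) < 0 then 2 * min ((g i)\<^sup>2) ((g (nxt i))\<^sup>2) else 0))"
  proof -
    have "(\<Sum>i<N. a (Inr i) * b (Inr i))
        = - (\<Sum>i<N. c i * (if g i * g (nxt i) < 0 then 2 * min ((g i)\<^sup>2) ((g (nxt i))\<^sup>2) else 0))"
      unfolding sum_negf[symmetric] by (intro sum.cong refl) (auto simp: a_def b_def)
    moreover have "(\<Sum>v<N. a (Inl v) * b (Inl v)) = (1 - s) * mass g"
      by (simp add: a_def b_def mass_def sum_distrib_left mult.assoc)
    ultimately show ?thesis unfolding I_def by (subst sum.Plus) simp_all
  qed
  also have "\<dots> = (\<Sum>i<N. c i * ((g i)\<^sup>2 + (g (nxt i))\<^sup>2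
      - (if g i * g (nxt i) < 0 then 2 * min ((g i)\<^sup>2) ((g (nxt i))\<^sup>2) else 0))) - s * mass g"
    by (simp add: mass_def sum_deg right_diff_distrib sum_subtractf left_diff_distrib)
  also have "\<dots> \<le> (\<Sum>i<N. c i * ((g i + g (nxt i))\<^sup>2 / s + s / 2 * ((g i)\<^sup>2 + (g (nxt i))\<^sup>2))) - s * mass g"
    using weight_pos \<open>s > 0\<close>
    by (intro diff_right_mono sum_mono mult_left_mono edge_inequality) (auto simp: less_imp_le)
  also have "\<dots> = energy g / s + s / 2 * mass g - s * mass g"
    by (simp add: energy_def mass_def sum_deg distrib_left sum.distrib sum_divide_distrib
        sum_distrib_left mult_ac)
  also have "\<dots> \<le> 0"
    using le \<open>s > 0\<close> by (simp add: field_simps power2_eq_square)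
  finally have nonpos: "\<not> (\<Sum>i\<in>I. a i * b i) > 0" by simp
  \<comment> \<open>If every level sum were positive, the whole sum would be, against
    \<open>nonpos\<close>.\<close>
  have "\<exists>t>0. (\<exists>i\<in>I. t \<le> b i) \<and> (\<Sum>i\<in>{i\<in>I. t \<le> b i}. a i) \<le> 0"
  proof (rule ccontr)
    assume contra: "\<not> ?thesis"
    have "(\<Sum>i\<in>I. a i * b i) > 0"
    proof (intro sum_pos_if_level_sums_pos)
      show "\<exists>i\<in>I. 0 < b i"
        using assms(3,4) by (intro bexI[of _ "Inl u"]) (auto simp: I_def b_def)
      show "(\<Sum>i\<in>{i\<in>I. t \<le> b i}. a i) > 0" if "t > 0" "\<exists>i\<in>I. t \<le> b i" for t
        using contra that by (meson not_le)
    qed (auto simp: I_def b_def)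
    with nonpos show False ..
  qed
  then obtain t where t: "t > 0" "\<exists>i\<in>I. t \<le> b i" "(\<Sum>i\<in>{i\<in>I. t \<le> b i}. a i) \<le> 0" by blast
  define A where "A = {v. v < N \<and> g v > 0 \<and> t \<le> (g v)\<^sup>2}"
  define B where "B = {v. v < N \<and> g v < 0 \<and> t \<le> (g v)\<^sup>2}"
  have un: "A \<union> B = {v\<in>{..<N}. t \<le> (g v)\<^sup>2}"
    using t(1) by (auto simp: A_def B_def) (metis not_le linorder_neqE_linordered_idom zero_power2)
  have "(\<Sum>i\<in>{i\<in>I. t \<le> b i}. a i) = (\<Sum>i\<in>I. if t \<le> b i then a i else 0)"
    by (simp add: I_def sum.inter_filter)
  also have "\<dots> = (\<Sum>v<N. if t \<le> (g v)\<^sup>2 then (1 - s) * cyc_deg N c v else 0)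
      + (\<Sum>i<N. if t \<le> min ((g i)\<^sup>2) ((g (nxt i))\<^sup>2) then
          (if g i * g (nxt i) < 0 then - 2 * c i else 0) else 0)"
    unfolding I_def by (subst sum.Plus) (simp_all add: a_def b_def cong: if_cong)
  also have "(\<Sum>v<N. if t \<le> (g v)\<^sup>2 then (1 - s) * cyc_deg N c v else 0)
      = (1 - s) * cyc_vol N c (A \<union> B)"
    unfolding cyc_vol_def un sum_distrib_left by (rule sum.inter_filter[symmetric]) simp
  also have "(\<Sum>i<N. if t \<le> min ((g i)\<^sup>2) ((g (nxt i))\<^sup>2) then
          (if g i * g (nxt i) < 0 then - 2 * c i else 0) else 0) = - 2 * cyc_E N c A B"
  proof -
    have "cyc_E N c A B = (\<Sum>u<N. \<Sum>v<N. cyc_w N c u v * (if u \<in> A \<and> v \<in> B then 1 else 0))"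
    proof -
      have "(\<Sum>u<N. \<Sum>v<N. cyc_w N c u v * (if u \<in> A \<and> v \<in> B then 1 else 0))
          = (\<Sum>u<N. if u \<in> A then \<Sum>v<N. if v \<in> B then cyc_w N c u v else 0 else 0)"
        by (intro sum.cong refl) (auto intro!: sum.cong)
      also have "\<dots> = (\<Sum>u\<in>{u\<in>{..<N}. u \<in> A}. \<Sum>v\<in>{v\<in>{..<N}. v \<in> B}. cyc_w N c u v)"
        by (simp only: sum.inter_filter finite_lessThan)
      also have "{u\<in>{..<N}. u \<in> A} = A" by (auto simp: A_def)
      also have "{v\<in>{..<N}. v \<in> B} = B" by (auto simp: B_def)
      finally show ?thesis by (simp add: cyc_E_def)
    qed
    also have "\<dots> = (\<Sum>i<N. c i * ((if i \<in> A \<and> nxt i \<in> B then 1 else 0)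
        + (if nxt i \<in> A \<and> i \<in> B then 1 else 0)))"
      by (rule sum_edges)
    finally show ?thesis
      unfolding sum_distrib_left
      by (simp only: sum_distrib_left)
        (intro sum.cong refl, auto simp: A_def B_def nxt_less mult_less_0_iff)
  qed
  finally have "(1 - s) * cyc_vol N c (A \<union> B) \<le> 2 * cyc_E N c A B" using t(3) by simp
  \<comment> \<open>The index reaching level \<open>t\<close> may be an edge; then its two ends
    reach that level as well.\<close>
  moreover have ne: "A \<union> B \<noteq> {}" using t(2) nxt_less unfolding un by (auto simp: I_def b_def)
  then have "cyc_vol N c (A \<union> B) > 0" using un by (intro vol_pos) auto
  ultimately have "1 - s \<le> cyc_phi N c A B" by (simp add: cyc_phi_def field_simps)
  with ne show ?thesis by (intro that[of A B]) (auto simp: A_def B_def)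
qed

section \<open>Greedy cutting into disjointly supported functions\<close>

text \<open>Both functions vanish at the vertices 0 and \<open>a\<close>, whose removal separates
  the supports on the cycle, so no edge meets both supports.\<close>

lemma energy_mass_add_separated:
  assumes f: "\<And>u. f u \<noteq> 0 \<Longrightarrow> 1 \<le> u \<and> u < a" and g: "\<And>u. g u \<noteq> 0 \<Longrightarrow> a < u \<and> u < N"
    and "a < N"
  shows "energy (\<lambda>u. f u + g u) = energy f + energy g"
    and "mass (\<lambda>u. f u + g u) = mass f + mass g"
proof -
  have "f u = 0 \<or> g u = 0" for u using f[of u] g[of u] by force
  then have "(f u + g u)\<^sup>2 = (f u)\<^sup>2 + (g u)\<^sup>2" for u
    by (metis add.left_neutral add.right_neutral zero_power2)
  then show "mass (\<lambda>u. f u + g u) = mass f + mass g"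
    by (simp add: mass_def distrib_left sum.distrib)
  have "(f i + g i + (f (nxt i) + g (nxt i)))\<^sup>2 = (f i + f (nxt i))\<^sup>2 + (g i + g (nxt i))\<^sup>2"
    if "i < N" for i
  proof -
    have "(f i = 0 \<and> f (nxt i) = 0) \<or> (g i = 0 \<and> g (nxt i) = 0)"
    proof (cases "Suc i = N")
      case True
      then have "nxt i = 0" by (simp add: nxt_def)
      then show ?thesis using f[of 0] f[of i] g[of 0] \<open>a < N\<close> True by fastforce
    next
      case False
      then have "nxt i = Suc i" using that by (simp add: nxt_def)
      then show ?thesis using f[of i] f[of "Suc i"] g[of i] g[of "Suc i"] by fastforce
    qed
    then show ?thesis by auto
  qed
  then show "energy (\<lambda>u. f u + g u) = energy f + energy g"
    unfolding energy_def sum.distrib[symmetric] distrib_left[symmetric]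
    by (intro sum.cong refl) auto
qed

text \<open>Induction on \<open>m\<close> with a moving left end \<open>a\<close>: take the least
  \<open>b\<close> such that [\<open>a\<close>, \<open>b\<close>) carries a nonzero function with
  energy at most \<mu> times its mass, and recurse on [\<open>b\<close>, \<open>N\<close>). A family
  found there is extended by \<open>f0\<close>, a set \<open>Z\<close> by the last vertex
  \<open>e\<close> of the segment. The bound \<open>1 \<le> a\<close> keeps vertex 0 out of all
  supports, as the separation requires.\<close>

lemma disjoint_functions_or_hitting_set:
  assumes "1 \<le> a" and "a \<le> N"
  shows "(\<exists>g. (\<forall>i<m. (\<exists>u. g i u \<noteq> 0) \<and> (\<forall>u. g i u \<noteq> 0 \<longrightarrow> a \<le> u \<and> u < N)
            \<and> energy (g i) \<le> \<mu> * mass (g i))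
          \<and> (\<forall>i<m. \<forall>j<m. i \<noteq> j \<longrightarrow> (\<forall>u. g i u = 0 \<or> g j u = 0)))
    \<or> (\<exists>Z. finite Z \<and> card Z < m \<and>
          (\<forall>f. (\<exists>u. f u \<noteq> 0) \<longrightarrow> (\<forall>u. f u \<noteq> 0 \<longrightarrow> a \<le> u \<and> u < N \<and> u \<notin> Z)
            \<longrightarrow> \<mu> * mass f < energy f))"
  using assms
proof (induction m arbitrary: a)
  case 0
  show ?case by simp
next
  case (Suc m)
  define R where "R b f \<longleftrightarrow> (\<exists>u. f u \<noteq> 0) \<and> (\<forall>u. f u \<noteq> 0 \<longrightarrow> a \<le> u \<and> u < b)
    \<and> energy f \<le> \<mu> * mass f" for b f
  show ?case
  proof (cases "\<exists>f. R N f")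
    case False
    then show ?thesis
      by (intro disjI2 exI[of _ "{}"]) (simp add: R_def, meson not_le)
  next
    case True
    define b where "b = (LEAST b. \<exists>f. R b f)"
    from True have "\<exists>f. R b f" unfolding b_def by (rule LeastI)
    then obtain f0 where f0: "R b f0" by blast
    have "b \<le> N" unfolding b_def using True by (rule Least_le)
    have min: "\<not> R b' f" if "b' < b" for b' f
      using not_less_Least[of b' "\<lambda>b. \<exists>f. R b f"] that unfolding b_def by blast
    have "a < b" using f0 by (auto simp: R_def)
    then obtain e where e: "b = Suc e" "a \<le> e" by (cases b) auto
    have "1 \<le> b" using e by simp
    from Suc.IH[OF this \<open>b \<le> N\<close>] show ?thesis
    proof (elim disjE exE conjE)
      fix g
      assume g: "\<forall>i<m. (\<exists>u. g i u \<noteq> 0) \<and> (\<forall>u. g i u \<noteq> 0 \<longrightarrow> b \<le> u \<and> u < N)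
            \<and> energy (g i) \<le> \<mu> * mass (g i)"
        and disj: "\<forall>i<m. \<forall>j<m. i \<noteq> j \<longrightarrow> (\<forall>u. g i u = 0 \<or> g j u = 0)"
      define g' where "g' = g(m := f0)"
      have f0_disj: "f0 u = 0 \<or> g i u = 0" if "i < m" for i u
        using f0 g that unfolding R_def by (meson not_le)
      show ?thesis
      proof (rule disjI1, intro exI[of _ g'] conjI allI impI)
        fix i assume "i < Suc m"
        then show "\<exists>u. g' i u \<noteq> 0" "energy (g' i) \<le> \<mu> * mass (g' i)"
          using g f0 by (auto simp: g'_def R_def less_Suc_eq)
        fix u assume "g' i u \<noteq> 0"
        then show "a \<le> u" "u < N"
          using \<open>i < Suc m\<close> g f0 \<open>b \<le> N\<close> \<open>a < b\<close>
          by (force simp: g'_def R_def less_Suc_eq split: if_splits)+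
      next
        fix i j u assume "i < Suc m" "j < Suc m" "i \<noteq> j"
        then show "g' i u = 0 \<or> g' j u = 0"
          using disj f0_disj by (auto simp: g'_def less_Suc_eq)
      qed
    next
      fix Z
      assume Z: "finite Z" "card Z < m"
        and pos: "\<forall>f. (\<exists>u. f u \<noteq> 0) \<longrightarrow> (\<forall>u. f u \<noteq> 0 \<longrightarrow> b \<le> u \<and> u < N \<and> u \<notin> Z)
            \<longrightarrow> \<mu> * mass f < energy f"
      have "\<mu> * mass f < energy f"
        if nz: "\<exists>u. f u \<noteq> 0" and supp: "\<forall>u. f u \<noteq> 0 \<longrightarrow> a \<le> u \<and> u < N \<and> u \<notin> insert e Z" for f
      proof -
        \<comment> \<open>As \<open>f\<close> vanishes at \<open>e\<close>, the pieces live on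
          [\<open>a\<close>, \<open>e\<close>) and [\<open>b\<close>, \<open>N\<close>) and are
          separated by \<open>e\<close>. Minimality of \<open>b\<close> controls \<open>f1\<close>,
          and the property of \<open>Z\<close> controls \<open>f2\<close>.\<close>
        define f1 where "f1 u = (if u < e then f u else 0)" for u
        define f2 where "f2 u = (if u < e then 0 else f u)" for u
        have f_eq: "f = (\<lambda>u. f1 u + f2 u)" by (auto simp: f1_def f2_def)
        have f1: "(\<exists>u. f1 u \<noteq> 0) \<Longrightarrow> \<mu> * mass f1 < energy f1"
          using min[of e f1] supp e by (auto simp: R_def f1_def not_le split: if_splits)
        have supp2: "b \<le> u \<and> u < N \<and> u \<notin> Z" if "f2 u \<noteq> 0" for u
        proof -
          have "\<not> u < e" "f u \<noteq> 0" using that by (auto simp: f2_def split: if_splits)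
          then show ?thesis using supp e(1) by (auto simp: Suc_le_eq nat_less_le)
        qed
        have f2: "(\<exists>u. f2 u \<noteq> 0) \<Longrightarrow> \<mu> * mass f2 < energy f2"
          using pos supp2 by blast
        have zero: "h = (\<lambda>_. 0) \<Longrightarrow> \<mu> * mass h = energy h" for h
          by (simp add: mass_def energy_def)
        \<comment> \<open>A piece that vanishes identically gives equality, so both inequalities
          hold weakly; at least one piece is nonzero and makes the sum strict.\<close>
        have "\<mu> * mass f1 \<le> energy f1" "\<mu> * mass f2 \<le> energy f2"
          using f1 f2 zero[of f1] zero[of f2] by (fastforce simp: less_imp_le)+
        moreover have "(\<exists>u. f1 u \<noteq> 0) \<or> (\<exists>u. f2 u \<noteq> 0)" using nz f_eq
          by (metis add.left_neutral)
        ultimately have "\<mu> * mass f1 + \<mu> * mass f2 < energy f1 + energy f2"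
          using f1 f2 by fastforce
        moreover have "1 \<le> u \<and> u < e" if "f1 u \<noteq> 0" for u
          using that supp Suc.prems(1) by (force simp: f1_def split: if_splits)
        moreover have "e < u \<and> u < N" if "f2 u \<noteq> 0" for u using supp2[OF that] e by auto
        ultimately show ?thesis
          using energy_mass_add_separated[of f1 e f2] \<open>b \<le> N\<close> e
          unfolding f_eq by (simp add: distrib_left)
      qed
      then show ?thesis using Z
        by (intro disjI2 exI[of _ "insert e Z"]) (auto intro: le_less_trans[OF card_insert_le_m1])
    qed
  qed
qed

section \<open>From disjointly supported functions to the dual Cheeger constant\<close>

text \<open>\<open>valid_pairs\<close> leaves \<open>V\<close> free at indices from
  \<open>2*k\<close> on, so finiteness is proved for the values under \<open>Max\<close> rather than
  for the collections: each is the minimum of a subset of the finitely many values of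
  \<open>cyc_phi\<close> on pairs of subsets of the vertex set.\<close>

lemma hbar_values_finite:
  "finite ((\<lambda>V. Min ((\<lambda>i. cyc_phi N c (V (2*i)) (V (2*i+1))) ` {..<k})) ` {V. valid_pairs N k V})"
proof (rule finite_subset)
  let ?S = "(\<lambda>(A, B). cyc_phi N c A B) ` (Pow {..<N} \<times> Pow {..<N})"
  show "finite (Min ` Pow ?S)" by simp
  show "(\<lambda>V. Min ((\<lambda>i. cyc_phi N c (V (2*i)) (V (2*i+1))) ` {..<k})) ` {V. valid_pairs N k V}
      \<subseteq> Min ` Pow ?S"
  proof (rule image_subsetI)
    fix V assume "V \<in> {V. valid_pairs N k V}"
    then have sub: "V i \<in> Pow {..<N}" if "i < 2 * k" for i using that by (simp add: valid_pairs_def)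
    have "cyc_phi N c (V (2*i)) (V (2*i+1)) \<in> ?S" if "i < k" for i
      using sub[of "2 * i"] sub[of "2 * i + 1"] that
      by (intro image_eqI[of _ _ "(V (2*i), V (2*i+1))"]) auto
    then have "(\<lambda>i. cyc_phi N c (V (2*i)) (V (2*i+1))) ` {..<k} \<in> Pow ?S" by auto
    then show "Min ((\<lambda>i. cyc_phi N c (V (2*i)) (V (2*i+1))) ` {..<k}) \<in> Min ` Pow ?S"
      by (rule imageI)
  qed
qed

lemma hbar_ge:
  assumes "k \<ge> 1" and "valid_pairs N k V"
    and "\<And>i. i < k \<Longrightarrow> x \<le> cyc_phi N c (V (2*i)) (V (2*i+1))"
  shows "x \<le> hbar N c k"
proof -
  have "x \<le> Min ((\<lambda>i. cyc_phi N c (V (2*i)) (V (2*i+1))) ` {..<k})"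
    using assms(1,3) by (subst Min_ge_iff) (auto simp: lessThan_empty_iff)
  also have "\<dots> \<le> hbar N c k"
    unfolding hbar_def by (rule Max_ge[OF hbar_values_finite]) (use assms(2) in auto)
  finally show ?thesis .
qed

text \<open>The first pair of any collection already bounds its minimum by 1. The given valid
  \<open>V\<close> ensures that \<open>Max\<close> ranges over a nonempty set.\<close>

lemma hbar_le_1:
  assumes "k \<ge> 1" and "valid_pairs N k V"
  shows "hbar N c k \<le> 1"
  unfolding hbar_def
proof (subst Max_le_iff[OF hbar_values_finite])
  show "\<forall>x\<in>(\<lambda>V. Min ((\<lambda>i. cyc_phi N c (V (2*i)) (V (2*i+1))) ` {..<k})) ` {V. valid_pairs N k V}. x \<le> 1"
  proof clarify
    fix V assume V: "valid_pairs N k V"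
    have "Min ((\<lambda>i. cyc_phi N c (V (2*i)) (V (2*i+1))) ` {..<k}) \<le> cyc_phi N c (V (2*0)) (V (2*0+1))"
      using assms(1) by (intro Min_le imageI) auto
    also have "\<dots> \<le> 1"
    proof (rule phi_le_1)
      show "V (2*0) \<inter> V (2*0+1) = {}" "V (2*0) \<union> V (2*0+1) \<noteq> {}"
        "V (2*0) \<subseteq> {..<N}" "V (2*0+1) \<subseteq> {..<N}"
        using V assms(1) unfolding valid_pairs_def by auto
    qed
    finally show "Min ((\<lambda>i. cyc_phi N c (V (2*i)) (V (2*i+1))) ` {..<k}) \<le> 1" .
  qed
qed (use assms(2) in auto)

text \<open>Sweeping each \<open>g i\<close> separately yields a pair inside its support, and
  disjoint supports make the \<open>m\<close> pairs a valid collection.\<close>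

lemma dual_cheeger:
  assumes "m \<ge> 1"
    and nz: "\<And>i. i < m \<Longrightarrow> \<exists>u<N. g i u \<noteq> 0" and le: "\<And>i. i < m \<Longrightarrow> energy (g i) \<le> \<mu> * mass (g i)"
    and disj: "\<And>i j u. i < m \<Longrightarrow> j < m \<Longrightarrow> i \<noteq> j \<Longrightarrow> g i u = 0 \<or> g j u = 0"
  shows "(1 - hbar N c m)\<^sup>2 \<le> 2 * \<mu>"
proof -
  obtain u where "u < N" "g 0 u \<noteq> 0" using nz[of 0] assms(1) by auto
  then have "0 \<le> \<mu> * mass (g 0)" "mass (g 0) > 0"
    using energy_nonneg[of "g 0"] le[of 0] assms(1) mass_pos[of u "g 0"] by auto
  then have "\<mu> \<ge> 0" by (simp add: zero_le_mult_iff)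
  \<comment> \<open>The sweep needs a positive parameter, while \<mu> may be 0; hence the slack
    \<epsilon>, which is removed at the end. Nonnegativity of the left side is recorded because the
    final bound is squared.\<close>
  have key: "0 \<le> 1 - hbar N c m \<and> 1 - hbar N c m \<le> sqrt (2 * \<mu>) + \<epsilon>" if "\<epsilon> > 0" for \<epsilon>
  proof -
    define s where "s = sqrt (2 * \<mu>) + \<epsilon>"
    have s: "s > 0" using that \<open>\<mu> \<ge> 0\<close> by (simp add: s_def add_nonneg_pos)
    have "(sqrt (2 * \<mu>))\<^sup>2 \<le> s\<^sup>2" using that \<open>\<mu> \<ge> 0\<close> unfolding s_def by (intro power_mono) auto
    then have s2: "2 * \<mu> \<le> s\<^sup>2" using \<open>\<mu> \<ge> 0\<close> by simp
    define ok where "ok i A B \<longleftrightarrow> A \<subseteq> {v. v < N \<and> g i v \<noteq> 0} \<and> B \<subseteq> {v. v < N \<and> g i v \<noteq> 0}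
        \<and> A \<inter> B = {} \<and> A \<union> B \<noteq> {} \<and> 1 - s \<le> cyc_phi N c A B" for i A B
    have "\<exists>A B. ok i A B" if "i < m" for i
    proof -
      obtain u where u: "u < N" "g i u \<noteq> 0" using nz[OF \<open>i < m\<close>] by auto
      have "2 * energy (g i) \<le> 2 * \<mu> * mass (g i)" using le[OF \<open>i < m\<close>] by simp
      also have "\<dots> \<le> s\<^sup>2 * mass (g i)"
        using s2 mass_pos[of u "g i"] u by (intro mult_right_mono) auto
      finally obtain A B where "A \<subseteq> {v. v < N \<and> g i v \<noteq> 0}" "B \<subseteq> {v. v < N \<and> g i v \<noteq> 0}"
        "A \<inter> B = {}" "A \<union> B \<noteq> {}" "1 - s \<le> cyc_phi N c A B"
        by (rule sweep[where g = "g i", OF s _ u])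
      then have "ok i A B" by (simp add: ok_def)
      then show ?thesis by blast
    qed
    then obtain A B where "\<And>i. i < m \<Longrightarrow> ok i (A i) (B i)" by metis
    then have AB: "A i \<subseteq> {v. v < N \<and> g i v \<noteq> 0}" "B i \<subseteq> {v. v < N \<and> g i v \<noteq> 0}"
      "A i \<inter> B i = {}" "A i \<union> B i \<noteq> {}" "1 - s \<le> cyc_phi N c (A i) (B i)" if "i < m" for i
      using that by (simp_all add: ok_def)
    \<comment> \<open>Interleaving: the pair of \<open>g i\<close> occupies the indices
      \<open>2 * i\<close> and \<open>2 * i + 1\<close>, so \<open>j div 2\<close> tells which
      function \<open>V j\<close> comes from.\<close>
    define V where "V j = (if even j then A (j div 2) else B (j div 2))" for j
    have V_supp: "V j \<subseteq> {v. v < N \<and> g (j div 2) v \<noteq> 0}" if "j < 2 * m" for j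
      using AB(1,2)[of "j div 2"] that by (auto simp: V_def)
    have "V i \<inter> V j = {}" if "i < 2 * m" "j < 2 * m" "i \<noteq> j" for i j
    proof (cases "i div 2 = j div 2")
      case True
      then have "even i \<noteq> even j" using \<open>i \<noteq> j\<close> by (metis dvd_mult_div_cancel odd_two_times_div_two_succ)
      moreover have "j div 2 < m" using that by auto
      ultimately show ?thesis using True AB(3)[of "j div 2"] by (auto simp: V_def)
    next
      case False
      then show ?thesis
        using V_supp[OF that(1)] V_supp[OF that(2)] disj[of "i div 2" "j div 2"] that by fastforce
    qed
    moreover have V: "V (2 * i) = A i" "V (2 * i + 1) = B i" for i by (auto simp: V_def)
    moreover have "V j \<subseteq> {..<N}" if "j < 2 * m" for j using V_supp[OF that] by auto
    ultimately have valid: "valid_pairs N m V"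
      using AB(4) by (simp add: valid_pairs_def)
    have "1 - s \<le> hbar N c m"
      using AB(5) by (intro hbar_ge[OF assms(1) valid]) (simp only: V)
    then show ?thesis
      using hbar_le_1[OF assms(1) valid] by (simp add: s_def)
  qed
  have "1 - hbar N c m \<le> sqrt (2 * \<mu>)"
  proof (rule field_le_epsilon)
    fix \<epsilon> :: real assume "\<epsilon> > 0"
    from key[OF this] show "1 - hbar N c m \<le> sqrt (2 * \<mu>) + \<epsilon>" ..
  qed
  moreover have "0 \<le> 1 - hbar N c m" using key[of 1] by simp
  ultimately have "(1 - hbar N c m)\<^sup>2 \<le> (sqrt (2 * \<mu>))\<^sup>2" by (intro power_mono)
  then show ?thesis using \<open>\<mu> \<ge> 0\<close> by simp
qed

section \<open>Laplacian eigenvalues and real test functions\<close>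

lemma cyc_laplacian_selfadjoint:
  "selfadjoint_mat N (cyc_deg N c) (map_mat complex_of_real (cyc_laplacian N c))"
proof
  fix i j assume ij: "i < N" "j < N"
  have "cyc_deg N c i * cyc_laplacian N c $$ (i, j) = cyc_deg N c j * cyc_laplacian N c $$ (j, i)"
    using ij deg_pos[of i] deg_pos[of j]
    by (auto simp: cyc_laplacian_def right_diff_distrib cyc_w_sym[of i j])
  moreover have "map_mat complex_of_real (cyc_laplacian N c) $$ (i, j) = of_real (cyc_laplacian N c $$ (i, j))"
    "map_mat complex_of_real (cyc_laplacian N c) $$ (j, i) = of_real (cyc_laplacian N c $$ (j, i))"
    using ij by (simp_all add: cyc_laplacian_def)
  ultimately show "of_real (cyc_deg N c i) * map_mat complex_of_real (cyc_laplacian N c) $$ (i, j)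
      = of_real (cyc_deg N c j) * cnj (map_mat complex_of_real (cyc_laplacian N c) $$ (j, i))"
    by (simp only: complex_cnj_complex_of_real of_real_mult[symmetric])
qed (auto simp: cyc_laplacian_def deg_pos)

text \<open>The diagonal of the Laplacian contributes the mass and its adjacency part the energy
  minus the mass, with opposite signs. The form splits over real and imaginary parts because only
  the real part \<open>F u v\<close> of \<open>x u * cnj (x v)\<close> survives.\<close>

lemma laplacian_form:
  "Re (weighted_inner N (cyc_deg N c)
      (mat_apply N (map_mat complex_of_real (cyc_laplacian N c)) x) x)
    = 2 * (mass (\<lambda>u. Re (x u)) + mass (\<lambda>u. Im (x u)))
      - (energy (\<lambda>u. Re (x u)) + energy (\<lambda>u. Im (x u)))"
proof -
  define F where "F u v = Re (x u) * Re (x v) + Im (x u) * Im (x v)" for u v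
  have term_eq: "Re (of_real (cyc_deg N c u)
        * (map_mat complex_of_real (cyc_laplacian N c) $$ (u, v) * x v) * cnj (x u))
      = (if u = v then cyc_deg N c u * F u u else 0) - cyc_w N c u v * F u v"
    if "u < N" "v < N" for u v
  proof -
    have "cyc_deg N c u * cyc_laplacian N c $$ (u, v)
        = (if u = v then cyc_deg N c u else 0) - cyc_w N c u v"
      using that deg_pos[of u] by (simp add: cyc_laplacian_def right_diff_distrib)
    moreover have "Re (of_real (cyc_deg N c u)
        * (map_mat complex_of_real (cyc_laplacian N c) $$ (u, v) * x v) * cnj (x u))
      = cyc_deg N c u * cyc_laplacian N c $$ (u, v) * F u v"
      using that by (simp add: cyc_laplacian_def F_def algebra_simps)
    ultimately show ?thesis by (auto simp: left_diff_distrib)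
  qed
  have "Re (weighted_inner N (cyc_deg N c)
      (mat_apply N (map_mat complex_of_real (cyc_laplacian N c)) x) x)
    = (\<Sum>u<N. \<Sum>v<N. Re (of_real (cyc_deg N c u)
        * (map_mat complex_of_real (cyc_laplacian N c) $$ (u, v) * x v) * cnj (x u)))"
    unfolding weighted_inner_def mat_apply_def sum_distrib_left sum_distrib_right Re_sum ..
  also have "\<dots> = (\<Sum>u<N. \<Sum>v<N. (if u = v then cyc_deg N c u * F u u else 0) - cyc_w N c u v * F u v)"
    by (intro sum.cong refl term_eq) auto
  also have "\<dots> = (\<Sum>u<N. cyc_deg N c u * F u u) - (\<Sum>u<N. \<Sum>v<N. cyc_w N c u v * F u v)"
    by (simp add: sum_subtractf)
  also have "(\<Sum>u<N. \<Sum>v<N. cyc_w N c u v * F u v) = (\<Sum>i<N. c i * (F i (nxt i) + F (nxt i) i))"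
    by (rule sum_edges)
  also have "\<dots> = energy (\<lambda>u. Re (x u)) + energy (\<lambda>u. Im (x u)) - (\<Sum>u<N. cyc_deg N c u * F u u)"
    unfolding sum_deg energy_def sum.distrib[symmetric] sum_subtractf[symmetric]
    by (intro sum.cong refl) (simp add: F_def power2_eq_square algebra_simps)
  also have "(\<Sum>u<N. cyc_deg N c u * F u u) = mass (\<lambda>u. Re (x u)) + mass (\<lambda>u. Im (x u))"
    unfolding mass_def sum.distrib[symmetric]
    by (intro sum.cong refl) (simp add: F_def power2_eq_square algebra_simps)
  finally show ?thesis by simp
qed

lemma weighted_inner_self_mass:
  "Re (weighted_inner N (cyc_deg N c) x x) = mass (\<lambda>u. Re (x u)) + mass (\<lambda>u. Im (x u))"
  unfolding weighted_inner_self Re_complex_of_real mass_def sum.distrib[symmetric]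
  by (intro sum.cong refl) (simp add: cmod_power2 distrib_left)

text \<open>The index \<open>N - k\<close> counts from zero, so it denotes the eigenvalue \<lambda>
  with subscript \<open>N - k + 1\<close>. From this position on, the sorted list has exactly
  \<open>k\<close> entries, none smaller; multiplicities are kept by working with the multiset of
  roots.\<close>

lemma card_large_eigenvalues:
  assumes "1 \<le> k" and "k \<le> N"
  shows "k \<le> size (filter_mset (\<lambda>z. cyc_eigs N c ! (N - k) \<le> Re z)
    (proots (char_poly (map_mat complex_of_real (cyc_laplacian N c)))))"
proof -
  define M where "M = proots (char_poly (map_mat complex_of_real (cyc_laplacian N c)))"
  define xs where "xs = cyc_eigs N c"
  have "map_mat complex_of_real (cyc_laplacian N c) \<in> carrier_mat N N"
    by (simp add: cyc_laplacian_def)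
  then have size: "size M = N"
    unfolding M_def size_proots_complex using degree_monic_char_poly by blast
  have xs: "mset xs = image_mset Re M" "sorted xs" by (auto simp: xs_def cyc_eigs_def M_def)
  have len: "length xs = N" using arg_cong[OF xs(1), of size] size by simp
  have "xs ! (N - k) \<le> y" if "y \<in> set (drop (N - k) xs)" for y
  proof -
    obtain i where "i < k" "y = xs ! (N - k + i)"
      using \<open>y \<in> set (drop (N - k) xs)\<close> len assms(2) by (auto simp: in_set_conv_nth)
    then show ?thesis using sorted_nth_mono[OF xs(2), of "N - k" "N - k + i"] len assms by auto
  qed
  then have "filter (\<lambda>y. xs ! (N - k) \<le> y) (drop (N - k) xs) = drop (N - k) xs"
    by (intro filter_True) auto
  then have "k \<le> length (filter (\<lambda>y. xs ! (N - k) \<le> y) (drop (N - k) xs))"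
    using len assms(2) by simp
  also have "\<dots> \<le> length (filter (\<lambda>y. xs ! (N - k) \<le> y) (take (N - k) xs @ drop (N - k) xs))"
    by (simp only: filter_append length_append le_add2)
  also have "\<dots> = size (filter_mset (\<lambda>y. xs ! (N - k) \<le> y) (mset xs))"
    by (simp only: append_take_drop_id mset_filter[symmetric] size_mset)
  also have "\<dots> = size (filter_mset (\<lambda>z. xs ! (N - k) \<le> Re z) M)"
    unfolding xs(1) by (simp add: filter_mset_image_mset o_def)
  finally show ?thesis by (simp add: M_def xs_def)
qed

text \<open>The complex test vector is replaced by its real or imaginary part: energy and mass add
  over the two parts, so the inequality must hold for a part that is not zero. Cutting
  \<open>p\<close> and \<open>q\<close> off beyond \<open>N\<close> makes the support claim valid
  for all natural numbers.\<close>

lemma real_test_function: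
  assumes "1 \<le> k" and "k \<le> N" and "finite Z" and "card Z < k"
  obtains f where "\<exists>u. f u \<noteq> 0" and "\<And>u. f u \<noteq> 0 \<Longrightarrow> u < N \<and> u \<notin> Z"
    and "energy f \<le> (2 - cyc_eigs N c ! (N - k)) * mass f"
proof -
  define l where "l = cyc_eigs N c ! (N - k)"
  interpret L: selfadjoint_mat N "cyc_deg N c" "map_mat complex_of_real (cyc_laplacian N c)"
    by (rule cyc_laplacian_selfadjoint)
  have "card Z < size (filter_mset (\<lambda>z. l \<le> Re z)
      (proots (char_poly (map_mat complex_of_real (cyc_laplacian N c)))))"
    using card_large_eigenvalues[OF assms(1,2)] assms(4) by (simp add: l_def)
  from L.test_vector[OF assms(3) this]
  obtain x where x: "\<exists>u<N. x u \<noteq> 0" "\<And>u. u \<in> Z \<Longrightarrow> x u = 0"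
    and le: "l * Re (weighted_inner N (cyc_deg N c) x x) \<le> Re (weighted_inner N (cyc_deg N c)
      (mat_apply N (map_mat complex_of_real (cyc_laplacian N c)) x) x)" by blast
  define p where "p u = (if u < N then Re (x u) else 0)" for u
  define q where "q u = (if u < N then Im (x u) else 0)" for u
  have "energy (\<lambda>u. Re (x u)) = energy p" "energy (\<lambda>u. Im (x u)) = energy q"
    "mass (\<lambda>u. Re (x u)) = mass p" "mass (\<lambda>u. Im (x u)) = mass q"
    by (simp_all add: energy_def mass_def p_def q_def nxt_less)
  with le have sum_le: "energy p + energy q \<le> (2 - l) * mass p + (2 - l) * mass q"
    unfolding laplacian_form weighted_inner_self_mass by (simp add: algebra_simps)
  have zero: "energy f = 0 \<and> mass f = 0" if "\<not> (\<exists>u. f u \<noteq> 0)" for f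
    using that by (simp add: energy_def mass_def)
  have "(\<exists>u. p u \<noteq> 0) \<or> (\<exists>u. q u \<noteq> 0)"
    using x(1) by (auto simp: p_def q_def complex_eq_iff)
  then have "((\<exists>u. p u \<noteq> 0) \<and> energy p \<le> (2 - l) * mass p)
      \<or> ((\<exists>u. q u \<noteq> 0) \<and> energy q \<le> (2 - l) * mass q)"
    using sum_le zero[of p] zero[of q] by fastforce
  then show ?thesis
  proof (elim disjE conjE)
    assume "\<exists>u. p u \<noteq> 0" "energy p \<le> (2 - l) * mass p"
    then show ?thesis
      using x(2) by (intro that[of p]) (auto simp: p_def l_def split: if_splits)
  next
    assume "\<exists>u. q u \<noteq> 0" "energy q \<le> (2 - l) * mass q"
    then show ?thesis
      using x(2) by (intro that[of q]) (auto simp: q_def l_def split: if_splits)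
  qed
qed

section \<open>The eigenvalue bound for cycles\<close>

lemma dual_cheeger_cycle:
  assumes "1 \<le> k" and "k \<le> N"
  shows "(1 - (if k = 1 then hbar N c 1 else hbar N c (k - 1)))\<^sup>2
    \<le> 2 * (2 - cyc_eigs N c ! (N - k))"
proof (cases "k = 1")
  case True
  obtain f where f: "\<exists>u. f u \<noteq> 0" "\<And>u. f u \<noteq> 0 \<Longrightarrow> u < N \<and> u \<notin> {}"
    "energy f \<le> (2 - cyc_eigs N c ! (N - k)) * mass f"
    using real_test_function[OF assms, of "{}"] assms by auto
  have "(1 - hbar N c 1)\<^sup>2 \<le> 2 * (2 - cyc_eigs N c ! (N - k))"
    \<comment> \<open>For \<open>k = 1\<close> a single function suffices, with no prescribed zeros,
      which matches the convention that the constant at 0 is the one at 1.\<close>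
    by (rule dual_cheeger[where g = "\<lambda>_. f"]) (use f in auto)
  with True show ?thesis by simp
next
  case False
  define \<mu> where "\<mu> = 2 - cyc_eigs N c ! (N - k)"
  have "1 \<le> N" using three_le by simp
  from disjoint_functions_or_hitting_set[OF order.refl this, of "k - 1" \<mu>]
  have "(1 - hbar N c (k - 1))\<^sup>2 \<le> 2 * \<mu>"
  proof (elim disjE exE conjE)
    fix g
    assume g: "\<forall>i<k - 1. (\<exists>u. g i u \<noteq> 0) \<and> (\<forall>u. g i u \<noteq> 0 \<longrightarrow> 1 \<le> u \<and> u < N)
        \<and> energy (g i) \<le> \<mu> * mass (g i)"
      and disj: "\<forall>i<k - 1. \<forall>j<k - 1. i \<noteq> j \<longrightarrow> (\<forall>u. g i u = 0 \<or> g j u = 0)"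
    show ?thesis
      by (rule dual_cheeger[where g = g]) (use g disj False assms(1) in \<open>auto, blast\<close>)
  next
    fix Z
    assume Z: "finite Z" "card Z < k - 1"
      and pos: "\<forall>f. (\<exists>u. f u \<noteq> 0) \<longrightarrow> (\<forall>u. f u \<noteq> 0 \<longrightarrow> 1 \<le> u \<and> u < N \<and> u \<notin> Z)
        \<longrightarrow> \<mu> * mass f < energy f"
    \<comment> \<open>Opening the cycle at vertex 0 uses up one of the \<open>k\<close> dimensions;
      this is why \<open>k - 1\<close> functions result. A test function vanishing on
      \<open>Z\<close> and at 0 contradicts \<open>pos\<close>.\<close>
    have "card (insert 0 Z) < k" using Z by (auto simp: card_insert_if)
    then show ?thesis
    proof (rule real_test_function[OF assms finite.insertI[OF Z(1)]])
      fix f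
      assume f: "\<exists>u. f u \<noteq> 0" "\<And>u. f u \<noteq> 0 \<Longrightarrow> u < N \<and> u \<notin> insert 0 Z"
        "energy f \<le> (2 - cyc_eigs N c ! (N - k)) * mass f"
      have "1 \<le> u \<and> u < N \<and> u \<notin> Z" if "f u \<noteq> 0" for u
        using f(2)[OF that] by (cases u) auto
      with pos f(1) have "\<mu> * mass f < energy f" by blast
      with f(3) show ?thesis by (simp add: \<mu>_def)
    qed
  qed
  with False show ?thesis by (simp add: \<mu>_def)
qed

end

theorem theorem7p1:
  fixes N k :: nat and c :: "nat \<Rightarrow> real"
  assumes "N \<ge> 3"
    and "\<And>i. i < N \<Longrightarrow> c i > 0"
    and "1 \<le> k" and "k \<le> N"
  shows "2 - cyc_eigs N c ! (N - k)
           \<ge> (if odd (N - k + 1) \<or> N - k + 1 \<in> {N - 1, N} then 1/2 else 1/48)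
              * (1 - (if k = 1 then hbar N c 1 else hbar N c (k - 1)))^2"
proof -
  interpret weighted_cycle N c by unfold_locales (use assms in auto)
  let ?x = "(1 - (if k = 1 then hbar N c 1 else hbar N c (k - 1)))\<^sup>2"
  \<comment> \<open>Both possible constants are at most 1/2.\<close>
  have "(if odd (N - k + 1) \<or> N - k + 1 \<in> {N - 1, N} then 1/2 else 1/48) * ?x \<le> 1/2 * ?x"
    by (intro mult_right_mono) auto
  also have "\<dots> \<le> 2 - cyc_eigs N c ! (N - k)"
    using dual_cheeger_cycle[OF assms(3,4)] by simp
  finally show ?thesis .
qed

end
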